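(* Let $\Gamma$ be a directed graph endowed with a compact Hausdorff topology, and regard $\Gamma$ as a uniform space with the unique uniformity inducing this topology. Then $\Gamma$ is a profinite directed graph if and only if the set of cofinite entourages of $\Gamma$ is a base for the uniformity on $\Gamma$.
   Context: A directed graph is a set $\Gamma$ with a distinguished subset $V(\Gamma)$ (the vertices) and two functions $s,t\colon\Gamma\to V(\Gamma)$ (source and target) satisfying $s(x)=t(x)=x$ for all $x\in V(\Gamma)$. A map of directed graphs is a function preserving sources and targets. A topological directed graph is a directed graph $\Gamma$ endowed with a topology such that $s,t\colon\Gamma\to V(\Gamma)$ are continuous, where $V(\Gamma)$ has the subspace topology. A profinite directed graph is a topological directed graph that is the limit of an inverse system of finite discrete topological directed graphs and maps of directed graphs; equivalently, a compact Hausdorff totally disconnected topological directed graph. Every compact Hausdorff space $X$ has a unique uniformity inducing its topology, consisting of all neighborhoods of the diagonal in $X\times X$. An equivalence relation $R$ on a directed graph $\Gamma$ is compatible if $(x,y)\in R$ implies $(s(x),s(y))\in R$ and $(t(x),t(y))\in R$. It has finite index if $\Gamma/R$ is finite. If $\Gamma$ is a directed graph endowed with a uniformity, a cofinite entourage of $\Gamma$ is a compatible equivalence relation of finite index on $\Gamma$ which is also an entourage of $\Gamma$. *)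

theory Defs
  imports "HOL-Analysis.Analysis"
begin

section \<open>Directed graphs\<close>

text \<open>
  A directed graph is a set (here called \<open>arrows\<close>) containing its own vertices: a vertex is
  an element fixed by source and target. The values of the maps outside \<open>arrows\<close> are irrelevant.
\<close>

record 'a digraph =
  arrows :: "'a set"
  verts :: "'a set"
  src :: "'a \<Rightarrow> 'a"
  tgt :: "'a \<Rightarrow> 'a"

definition is_digraph :: "'a digraph \<Rightarrow> bool" where
  "is_digraph G \<longleftrightarrow>
     verts G \<subseteq> arrows G \<and>
     src G \<in> arrows G \<rightarrow> verts G \<and> tgt G \<in> arrows G \<rightarrow> verts G \<and>
     (\<forall>x \<in> verts G. src G x = x \<and> tgt G x = x)"

definition digraph_map :: "'a digraph \<Rightarrow> 'b digraph \<Rightarrow> ('a \<Rightarrow> 'b) \<Rightarrow> bool" where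
  "digraph_map G H f \<longleftrightarrow>
     f \<in> arrows G \<rightarrow> arrows H \<and>
     (\<forall>x \<in> arrows G. f (src G x) = src H (f x) \<and> f (tgt G x) = tgt H (f x))"

definition topological_digraph :: "'a digraph \<Rightarrow> 'a topology \<Rightarrow> bool" where
  "topological_digraph G X \<longleftrightarrow>
     is_digraph G \<and> topspace X = arrows G \<and>
     continuous_map X (subtopology X (verts G)) (src G) \<and>
     continuous_map X (subtopology X (verts G)) (tgt G)"

definition topological_digraph_iso ::
    "'a digraph \<Rightarrow> 'a topology \<Rightarrow> 'b digraph \<Rightarrow> 'b topology \<Rightarrow> ('a \<Rightarrow> 'b) \<Rightarrow> bool" where
  "topological_digraph_iso G X H Y f \<longleftrightarrow> digraph_map G H f \<and> homeomorphic_map X Y f"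


section \<open>Inverse limits of finite discrete directed graphs\<close>

text \<open>
  The index set \<open>I\<close> is directed by the partial order \<open>r\<close>, where \<open>(i, j) \<in> r\<close> means that
  \<open>i\<close> is below \<open>j\<close>, and the transition map \<open>\<phi> i j\<close> then goes from \<open>F j\<close> to \<open>F i\<close>.
\<close>

definition finite_inverse_system ::
    "'i set \<Rightarrow> 'i rel \<Rightarrow> ('i \<Rightarrow> 'b digraph) \<Rightarrow> ('i \<Rightarrow> 'i \<Rightarrow> 'b \<Rightarrow> 'b) \<Rightarrow> bool" where
  "finite_inverse_system I r F \<phi> \<longleftrightarrow>
     I \<noteq> {} \<and> partial_order_on I r \<and>
     (\<forall>i \<in> I. \<forall>j \<in> I. \<exists>k \<in> I. (i, k) \<in> r \<and> (j, k) \<in> r) \<and>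
     (\<forall>i \<in> I. is_digraph (F i) \<and> finite (arrows (F i))) \<and>
     (\<forall>(i, j) \<in> r. digraph_map (F j) (F i) (\<phi> i j)) \<and>
     (\<forall>i \<in> I. \<forall>x \<in> arrows (F i). \<phi> i i x = x) \<and>
     (\<forall>i j k. (i, j) \<in> r \<and> (j, k) \<in> r \<longrightarrow>
        (\<forall>x \<in> arrows (F k). \<phi> i j (\<phi> j k x) = \<phi> i k x))"

definition inverse_limit ::
    "'i set \<Rightarrow> 'i rel \<Rightarrow> ('i \<Rightarrow> 'b digraph) \<Rightarrow> ('i \<Rightarrow> 'i \<Rightarrow> 'b \<Rightarrow> 'b) \<Rightarrow> ('i \<Rightarrow> 'b) digraph" where
  "inverse_limit I r F \<phi> =
     \<lparr>arrows = {x \<in> \<Pi>\<^sub>E i \<in> I. arrows (F i). \<forall>(i, j) \<in> r. \<phi> i j (x j) = x i},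
      verts = {x \<in> \<Pi>\<^sub>E i \<in> I. verts (F i). \<forall>(i, j) \<in> r. \<phi> i j (x j) = x i},
      src = (\<lambda>x. \<lambda>i \<in> I. src (F i) (x i)),
      tgt = (\<lambda>x. \<lambda>i \<in> I. tgt (F i) (x i))\<rparr>"

definition inverse_limit_topology ::
    "'i set \<Rightarrow> 'i rel \<Rightarrow> ('i \<Rightarrow> 'b digraph) \<Rightarrow> ('i \<Rightarrow> 'i \<Rightarrow> 'b \<Rightarrow> 'b) \<Rightarrow> ('i \<Rightarrow> 'b) topology" where
  "inverse_limit_topology I r F \<phi> =
     subtopology (product_topology (\<lambda>i. discrete_topology (arrows (F i))) I)
       (arrows (inverse_limit I r F \<phi>))"

definition is_limit_of ::
    "'a digraph \<Rightarrow> 'a topology \<Rightarrow>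
     'i set \<Rightarrow> 'i rel \<Rightarrow> ('i \<Rightarrow> 'b digraph) \<Rightarrow> ('i \<Rightarrow> 'i \<Rightarrow> 'b \<Rightarrow> 'b) \<Rightarrow> bool" where
  "is_limit_of G X I r F \<phi> \<longleftrightarrow>
     finite_inverse_system I r F \<phi> \<and>
     (\<exists>f. topological_digraph_iso G X (inverse_limit I r F \<phi>) (inverse_limit_topology I r F \<phi>) f)"

text \<open>
  A definition cannot quantify over types, so the inverse system is taken with carriers in
  \<^typ>\<open>nat\<close> and indices in \<^typ>\<open>('a \<times> 'a) set\<close>. This is no restriction: by the theorem
  \<open>profinite_digraphI\<close> below, a limit of an inverse system over arbitrary types is also a limit
  of a system over these types.
\<close>

definition profinite_digraph :: "'a digraph \<Rightarrow> 'a topology \<Rightarrow> bool" where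
  "profinite_digraph G X \<longleftrightarrow>
     topological_digraph G X \<and>
     (\<exists>(I :: ('a \<times> 'a) set set) r (F :: ('a \<times> 'a) set \<Rightarrow> nat digraph) \<phi>. is_limit_of G X I r F \<phi>)"


section \<open>Uniformities\<close>

text \<open>
  The library's class \<^class>\<open>uniform_space\<close> puts a uniformity on a whole type; here it lives on
  the carrier of a \<open>topology\<close>.
\<close>

definition is_uniformity :: "'a set \<Rightarrow> ('a \<times> 'a) set set \<Rightarrow> bool" where
  "is_uniformity A \<U> \<longleftrightarrow>
     \<U> \<noteq> {} \<and>
     (\<forall>U \<in> \<U>. Id_on A \<subseteq> U \<and> U \<subseteq> A \<times> A) \<and>
     (\<forall>U \<in> \<U>. \<forall>V. U \<subseteq> V \<and> V \<subseteq> A \<times> A \<longrightarrow> V \<in> \<U>) \<and>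
     (\<forall>U \<in> \<U>. \<forall>V \<in> \<U>. U \<inter> V \<in> \<U>) \<and>
     (\<forall>U \<in> \<U>. U\<inverse> \<in> \<U>) \<and>
     (\<forall>U \<in> \<U>. \<exists>V \<in> \<U>. V O V \<subseteq> U)"

definition induces_topology :: "('a \<times> 'a) set set \<Rightarrow> 'a topology \<Rightarrow> bool" where
  "induces_topology \<U> X \<longleftrightarrow>
     (\<forall>S. openin X S \<longleftrightarrow> S \<subseteq> topspace X \<and> (\<forall>x \<in> S. \<exists>U \<in> \<U>. U `` {x} \<subseteq> S))"

definition is_uniformity_base :: "('a \<times> 'a) set set \<Rightarrow> ('a \<times> 'a) set set \<Rightarrow> bool" where
  "is_uniformity_base \<B> \<U> \<longleftrightarrow> \<B> \<subseteq> \<U> \<and> (\<forall>U \<in> \<U>. \<exists>B \<in> \<B>. B \<subseteq> U)"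

definition diagonal_nhds :: "'a topology \<Rightarrow> ('a \<times> 'a) set set" where
  "diagonal_nhds X =
     {U. U \<subseteq> topspace X \<times> topspace X \<and>
         (\<exists>W. openin (prod_topology X X) W \<and> Id_on (topspace X) \<subseteq> W \<and> W \<subseteq> U)}"


section \<open>Cofinite entourages\<close>

definition compatible_equiv :: "'a digraph \<Rightarrow> ('a \<times> 'a) set \<Rightarrow> bool" where
  "compatible_equiv G R \<longleftrightarrow>
     equiv (arrows G) R \<and>
     (\<forall>(x, y) \<in> R. (src G x, src G y) \<in> R \<and> (tgt G x, tgt G y) \<in> R)"

definition cofinite_entourage ::
    "'a digraph \<Rightarrow> ('a \<times> 'a) set set \<Rightarrow> ('a \<times> 'a) set \<Rightarrow> bool" where
  "cofinite_entourage G \<U> R \<longleftrightarrow>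
     compatible_equiv G R \<and> finite (arrows G // R) \<and> R \<in> \<U>"


section \<open>The uniformity of a compact Hausdorff space\<close>

lemma compact_pointwise_cover:
  assumes "compact_space X"
    and "\<And>x. x \<in> topspace X \<Longrightarrow> openin X (M x)" "\<And>x. x \<in> topspace X \<Longrightarrow> x \<in> M x"
  shows "\<exists>T. finite T \<and> T \<subseteq> topspace X \<and> topspace X \<subseteq> (\<Union>x \<in> T. M x)"
proof -
  have "topspace X \<subseteq> \<Union> (M ` topspace X)" using assms by auto
  moreover have "\<forall>U \<in> M ` topspace X. openin X U" using assms by auto
  ultimately obtain \<F> where F: "finite \<F>" "\<F> \<subseteq> M ` topspace X" "topspace X \<subseteq> \<Union>\<F>"
    using assms(1) unfolding compact_space_alt by meson
  obtain T where "T \<subseteq> topspace X" "finite T" "\<F> = M ` T"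
    using finite_subset_image[OF F(1,2)] by blast
  then show ?thesis using F(3) by blast
qed

lemma induced_uniformity_eq_diagonal_nhds:
  assumes comp: "compact_space X"
    and U: "is_uniformity (topspace X) \<U>" and ind: "induces_topology \<U> X"
  shows "\<U> = diagonal_nhds X"
proof -
  let ?A = "topspace X"
  note u = U[unfolded is_uniformity_def]
  have ne: "\<U> \<noteq> {}" using u by (rule conjunct1)
  have refl: "Id_on ?A \<subseteq> U" and sub: "U \<subseteq> ?A \<times> ?A" if "U \<in> \<U>" for U
    using u[THEN conjunct2, THEN conjunct1] that by blast+
  have up: "V \<in> \<U>" if "U \<in> \<U>" "U \<subseteq> V" "V \<subseteq> ?A \<times> ?A" for U V
    using u[THEN conjunct2, THEN conjunct2, THEN conjunct1] that by blast
  have int: "U \<inter> V \<in> \<U>" if "U \<in> \<U>" "V \<in> \<U>" for U V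
    using u[THEN conjunct2, THEN conjunct2, THEN conjunct2, THEN conjunct1] that by blast
  have conv: "U\<inverse> \<in> \<U>" if "U \<in> \<U>" for U
    using u[THEN conjunct2, THEN conjunct2, THEN conjunct2, THEN conjunct2, THEN conjunct1] that
    by blast
  have half: "\<exists>V \<in> \<U>. V O V \<subseteq> U" if "U \<in> \<U>" for U
    using u[THEN conjunct2, THEN conjunct2, THEN conjunct2, THEN conjunct2, THEN conjunct2] that
    by blast
  have op: "\<And>S. openin X S \<longleftrightarrow> S \<subseteq> ?A \<and> (\<forall>x \<in> S. \<exists>U \<in> \<U>. U `` {x} \<subseteq> S)"
    using ind unfolding induces_topology_def by blast
  define N where "N W x = {y \<in> ?A. \<exists>E \<in> \<U>. E `` {y} \<subseteq> W `` {x}}" for W and x :: 'a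
  have Nop: "openin X (N W x)" for W x
    unfolding op
  proof (intro conjI ballI)
    fix y assume "y \<in> N W x"
    then obtain E where E: "E \<in> \<U>" "E `` {y} \<subseteq> W `` {x}" by (auto simp: N_def)
    obtain D where D: "D \<in> \<U>" "D O D \<subseteq> E" using half E by blast
    have "D `` {y} \<subseteq> N W x"
    proof
      fix z assume z: "z \<in> D `` {y}"
      then have "D `` {z} \<subseteq> E `` {y}" using D by blast
      then have "D `` {z} \<subseteq> W `` {x}" using E(2) by (rule order_trans)
      moreover have "z \<in> ?A" using z sub[OF D(1)] by blast
      ultimately show "z \<in> N W x" using D(1) unfolding N_def by blast
    qed
    then show "\<exists>D \<in> \<U>. D `` {y} \<subseteq> N W x" using D by blast
  qed (auto simp: N_def)
  have Nin: "x \<in> N W x" if "W \<in> \<U>" "x \<in> ?A" for W x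
    using that by (auto simp: N_def)
  have Nsub: "N W x \<subseteq> W `` {x}" for W x
  proof
    fix y assume "y \<in> N W x"
    then obtain E where "y \<in> ?A" "E \<in> \<U>" "E `` {y} \<subseteq> W `` {x}" by (auto simp: N_def)
    then show "y \<in> W `` {x}" using refl[of E] by blast
  qed
  show ?thesis
  proof (intro equalityI subsetI)
    fix U assume UU: "U \<in> \<U>"
    obtain V where V: "V \<in> \<U>" "V O V \<subseteq> U" using half UU by blast
    define W where "W = V \<inter> V\<inverse>"
    have W: "W \<in> \<U>" using V int conv by (auto simp: W_def)
    have sq: "N W x \<times> N W x \<subseteq> U" for x
    proof (clarify)
      fix y z assume "y \<in> N W x" "z \<in> N W x"
      then have "(x, y) \<in> W" "(x, z) \<in> W" using Nsub by blast+
      then show "(y, z) \<in> U" using V by (auto simp: W_def)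
    qed
    have "openin (prod_topology X X) (\<Union>x \<in> ?A. N W x \<times> N W x)"
      by (intro openin_Union) (auto intro: openin_prod_Times_iff[THEN iffD2] Nop)
    moreover have "Id_on ?A \<subseteq> (\<Union>x \<in> ?A. N W x \<times> N W x)"
      using Nin W by (auto simp: Id_on_def)
    ultimately show "U \<in> diagonal_nhds X"
      using sq sub[OF UU] unfolding diagonal_nhds_def by blast
  next
    fix U assume "U \<in> diagonal_nhds X"
    then obtain W where UA: "U \<subseteq> ?A \<times> ?A" and W: "openin (prod_topology X X) W"
      "Id_on ?A \<subseteq> W" "W \<subseteq> U" unfolding diagonal_nhds_def by blast
    have ex: "\<exists>V \<in> \<U>. \<forall>y z. y \<in> N V x \<and> (y, z) \<in> V \<longrightarrow> (y, z) \<in> U" if x: "x \<in> ?A" for x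
    proof -
      have "(x, x) \<in> W" using W x by (auto simp: Id_on_def)
      then obtain P Q where PQ: "openin X P" "openin X Q" "x \<in> P" "x \<in> Q" "P \<times> Q \<subseteq> W"
        using W(1) unfolding openin_prod_topology_alt by meson
      then have "openin X (P \<inter> Q)" by blast
      then obtain E where E: "E \<in> \<U>" "E `` {x} \<subseteq> P \<inter> Q" using PQ op by blast
      obtain V where V: "V \<in> \<U>" "V O V \<subseteq> E" using half E by blast
      have "(y, z) \<in> U" if "y \<in> N V x" "(y, z) \<in> V" for y z
      proof -
        have xy: "(x, y) \<in> V" using Nsub that by blast
        then have "(x, z) \<in> E" using that V by blast
        moreover have "(x, y) \<in> E"
        proof -
          have "(y, y) \<in> V" using refl[OF V(1)] sub[OF V(1)] xy by (auto simp: Id_on_def)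
          then show ?thesis using xy V by blast
        qed
        ultimately show ?thesis using E PQ W by blast
      qed
      then show ?thesis using V by blast
    qed
    then obtain V where V: "\<And>x. x \<in> ?A \<Longrightarrow> V x \<in> \<U>"
      "\<And>x y z. \<lbrakk>x \<in> ?A; y \<in> N (V x) x; (y, z) \<in> V x\<rbrakk> \<Longrightarrow> (y, z) \<in> U" by metis
    have "x \<in> N (V x) x" if "x \<in> ?A" for x using Nin V(1) that by blast
    then obtain T where T: "finite T" "T \<subseteq> ?A" "?A \<subseteq> (\<Union>x \<in> T. N (V x) x)"
      using compact_pointwise_cover[OF comp, of "\<lambda>x. N (V x) x"] Nop by metis
    have fin: "?A \<times> ?A \<inter> (\<Inter>x \<in> T. V x) \<in> \<U>" using T(1,2)
    proof (induction T)
      case empty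
      obtain U' where "U' \<in> \<U>" using ne by blast
      then show ?case using up[of U' "?A \<times> ?A"] sub by auto
    next
      case (insert x T)
      then have "V x \<inter> (?A \<times> ?A \<inter> (\<Inter>x \<in> T. V x)) \<in> \<U>" using int V by simp
      then show ?case by (simp add: Int_left_commute Int_assoc)
    qed
    moreover have "?A \<times> ?A \<inter> (\<Inter>x \<in> T. V x) \<subseteq> U"
    proof clarify
      fix y z assume yz: "y \<in> ?A" "z \<in> ?A" "(y, z) \<in> (\<Inter>x \<in> T. V x)"
      then obtain x where "x \<in> T" "y \<in> N (V x) x" using T by blast
      then show "(y, z) \<in> U" using V T yz by blast
    qed
    ultimately show "U \<in> \<U>" using up UA by blast
  qed
qed

lemma diagonal_nhds_uniformity:
  assumes comp: "compact_space X" and haus: "Hausdorff_space X"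
  shows "is_uniformity (topspace X) (diagonal_nhds X)" "induces_topology (diagonal_nhds X) X"
proof -
  let ?A = "topspace X"
  have reg: "neighbourhood_base_of (closedin X) X"
    using compact_Hausdorff_imp_regular_space[OF comp haus] neighbourhood_base_of_closedin by blast
  have half: "\<exists>V. openin (prod_topology X X) V \<and> Id_on ?A \<subseteq> V \<and> V O V \<subseteq> W"
    if W: "openin (prod_topology X X) W" "Id_on ?A \<subseteq> W" for W
  proof -
    have "\<exists>N M C. openin X N \<and> openin X M \<and> closedin X C \<and> x \<in> M \<and> M \<subseteq> C \<and> C \<subseteq> N \<and> N \<times> N \<subseteq> W"
      if x: "x \<in> ?A" for x
    proof -
      have "(x, x) \<in> W" using W x by (auto simp: Id_on_def)
      then obtain P Q where PQ: "openin X P" "openin X Q" "x \<in> P" "x \<in> Q" "P \<times> Q \<subseteq> W"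
        using W(1) unfolding openin_prod_topology_alt by meson
      then have "openin X (P \<inter> Q)" "x \<in> P \<inter> Q" by blast+
      then obtain M C where "openin X M" "closedin X C" "x \<in> M" "M \<subseteq> C" "C \<subseteq> P \<inter> Q"
        using reg unfolding neighbourhood_base_of by metis
      moreover have "(P \<inter> Q) \<times> (P \<inter> Q) \<subseteq> W" using PQ by blast
      ultimately show ?thesis using \<open>openin X (P \<inter> Q)\<close> by metis
    qed
    then obtain N M C where NMC: "\<And>x. x \<in> ?A \<Longrightarrow> openin X (N x) \<and> openin X (M x) \<and>
        closedin X (C x) \<and> x \<in> M x \<and> M x \<subseteq> C x \<and> C x \<subseteq> N x \<and> N x \<times> N x \<subseteq> W" by metis
    then obtain T where T: "finite T" "T \<subseteq> ?A" "?A \<subseteq> (\<Union>x \<in> T. M x)"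
      using compact_pointwise_cover[OF comp, of M] by metis
    define D where "D x = N x \<times> N x \<union> (?A - C x) \<times> (?A - C x)" for x
    define V where "V = ?A \<times> ?A \<inter> (\<Inter>x \<in> T. D x)"
    have Dop: "openin (prod_topology X X) (D x)" if "x \<in> ?A" for x
      unfolding D_def using NMC[OF that]
      by (intro openin_Un) (auto simp: openin_prod_Times_iff)
    have "openin (prod_topology X X) V" unfolding V_def using T(1,2)
    proof (induction T)
      case empty
      then show ?case by (simp add: openin_prod_Times_iff)
    next
      case (insert x T)
      then have "openin (prod_topology X X) (D x \<inter> (?A \<times> ?A \<inter> (\<Inter>x \<in> T. D x)))"
        by (intro openin_Int[OF Dop]) auto
      then show ?case by (simp add: Int_left_commute Int_assoc)
    qed
    moreover have "Id_on ?A \<subseteq> V"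
    proof -
      have "(y, y) \<in> D x" if "y \<in> ?A" "x \<in> T" for x y
      proof -
        have "C x \<subseteq> N x" using NMC T(2) that(2) by blast
        then show ?thesis using that(1) unfolding D_def by blast
      qed
      then show ?thesis by (auto simp: V_def Id_on_def)
    qed
    moreover have "V O V \<subseteq> W"
    proof clarify
      fix a b c assume abc: "(a, b) \<in> V" "(b, c) \<in> V"
      then have "b \<in> ?A" by (auto simp: V_def)
      then obtain x where x: "x \<in> T" "b \<in> M x" using T by blast
      then have "x \<in> ?A" using T(2) by blast
      note Nx = NMC[OF this]
      have "b \<in> C x" using Nx x(2) by blast
      moreover have "(a, b) \<in> D x" "(b, c) \<in> D x" using abc x by (auto simp: V_def)
      ultimately have "a \<in> N x" "c \<in> N x" by (auto simp: D_def)
      then show "(a, c) \<in> W" using Nx by blast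
    qed
    ultimately show ?thesis by blast
  qed
  show "is_uniformity ?A (diagonal_nhds X)"
    unfolding is_uniformity_def
  proof (intro conjI ballI allI impI)
    have "?A \<times> ?A \<in> diagonal_nhds X"
      unfolding diagonal_nhds_def by (auto simp: openin_prod_Times_iff intro!: exI[of _ "?A \<times> ?A"])
    then show "diagonal_nhds X \<noteq> {}" by blast
  next
    fix U V assume "U \<in> diagonal_nhds X" "V \<in> diagonal_nhds X"
    then obtain W W' where W: "openin (prod_topology X X) W" "Id_on ?A \<subseteq> W" "W \<subseteq> U"
      "openin (prod_topology X X) W'" "Id_on ?A \<subseteq> W'" "W' \<subseteq> V" and UA: "U \<subseteq> ?A \<times> ?A"
      unfolding diagonal_nhds_def by blast
    have "openin (prod_topology X X) (W \<inter> W')" using W by blast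
    then show "U \<inter> V \<in> diagonal_nhds X" using W UA unfolding diagonal_nhds_def by blast
  next
    fix U assume "U \<in> diagonal_nhds X"
    then obtain W where W: "openin (prod_topology X X) W" "Id_on ?A \<subseteq> W" "W \<subseteq> U"
      and UA: "U \<subseteq> ?A \<times> ?A" unfolding diagonal_nhds_def by blast
    have "openin (prod_topology X X) (W\<inverse>)"
      unfolding openin_prod_topology_alt
    proof (intro allI impI)
      fix x y assume "(x, y) \<in> W\<inverse>"
      then have "(y, x) \<in> W" by simp
      then obtain P Q where PQ: "openin X P" "openin X Q" "y \<in> P" "x \<in> Q" "P \<times> Q \<subseteq> W"
        using W(1) unfolding openin_prod_topology_alt by meson
      then have "Q \<times> P \<subseteq> W\<inverse>" by blast
      then show "\<exists>P Q. openin X P \<and> openin X Q \<and> x \<in> P \<and> y \<in> Q \<and> P \<times> Q \<subseteq> W\<inverse>"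
        using PQ by metis
    qed
    moreover have "Id_on ?A \<subseteq> W\<inverse>" "W\<inverse> \<subseteq> U\<inverse>" "U\<inverse> \<subseteq> ?A \<times> ?A"
      using W UA by (auto simp: Id_on_def)
    ultimately show "U\<inverse> \<in> diagonal_nhds X" unfolding diagonal_nhds_def by blast
  next
    fix U assume "U \<in> diagonal_nhds X"
    then obtain W where W: "openin (prod_topology X X) W" "Id_on ?A \<subseteq> W" "W \<subseteq> U"
      and UA: "U \<subseteq> ?A \<times> ?A" unfolding diagonal_nhds_def by blast
    obtain V where V: "openin (prod_topology X X) V" "Id_on ?A \<subseteq> V" "V O V \<subseteq> W"
      using half W by metis
    then have "V \<in> diagonal_nhds X" using openin_subset[OF V(1)] by (auto simp: diagonal_nhds_def)
    then show "\<exists>V \<in> diagonal_nhds X. V O V \<subseteq> U" using V W by blast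
  next
    fix U assume U: "U \<in> diagonal_nhds X"
    then show "Id_on ?A \<subseteq> U" "U \<subseteq> ?A \<times> ?A" by (auto simp: diagonal_nhds_def)
    fix V assume "U \<subseteq> V \<and> V \<subseteq> ?A \<times> ?A"
    then show "V \<in> diagonal_nhds X" using U order_trans unfolding diagonal_nhds_def by blast
  qed
  show "induces_topology (diagonal_nhds X) X"
    unfolding induces_topology_def
  proof (intro allI iffI conjI ballI)
    fix S x assume S: "openin X S" and x: "x \<in> S"
    let ?W = "S \<times> S \<union> (?A - {x}) \<times> ?A"
    have SA: "S \<subseteq> ?A" using S openin_subset by blast
    have "closedin X {x}" using x SA by (intro closedin_Hausdorff_singleton[OF haus]) auto
    then have "openin X (?A - {x})" by blast
    then have "openin (prod_topology X X) ?W"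
      using S by (intro openin_Un) (auto simp: openin_prod_Times_iff)
    then have "?W \<in> diagonal_nhds X" using SA x by (auto simp: diagonal_nhds_def Id_on_def)
    moreover have "?W `` {x} \<subseteq> S" by auto
    ultimately show "\<exists>U \<in> diagonal_nhds X. U `` {x} \<subseteq> S" by blast
  next
    fix S assume S: "S \<subseteq> ?A \<and> (\<forall>x \<in> S. \<exists>U \<in> diagonal_nhds X. U `` {x} \<subseteq> S)"
    show "openin X S"
    proof (subst openin_subopen, intro ballI)
      fix x assume x: "x \<in> S"
      then obtain U W where U: "U `` {x} \<subseteq> S" "openin (prod_topology X X) W" "Id_on ?A \<subseteq> W" "W \<subseteq> U"
        using S unfolding diagonal_nhds_def by blast
      have "x \<in> ?A" using x S by blast
      then have "(x, x) \<in> W" using U(3) by blast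
      then obtain P Q where PQ: "openin X Q" "x \<in> P" "x \<in> Q" "P \<times> Q \<subseteq> W"
        using U(2) unfolding openin_prod_topology_alt by meson
      then have "Q \<subseteq> S" using U by blast
      then show "\<exists>T. openin X T \<and> x \<in> T \<and> T \<subseteq> S" using PQ by blast
    qed
  next
    fix S assume "openin X S" then show "S \<subseteq> ?A" by (rule openin_subset)
  qed
qed

theorem compact_Hausdorff_uniformity:
  assumes "compact_space X" "Hausdorff_space X"
  shows "is_uniformity (topspace X) \<U> \<and> induces_topology \<U> X \<longleftrightarrow> \<U> = diagonal_nhds X"
  using induced_uniformity_eq_diagonal_nhds[OF assms(1)] diagonal_nhds_uniformity[OF assms] by blast


section \<open>Independence of the types of the inverse system\<close>

theorem profinite_digraphI:
  fixes G :: "'a digraph" and I :: "'i set" and F :: "'i \<Rightarrow> 'b digraph"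
  assumes top: "topological_digraph G X" and lim: "is_limit_of G X I r F \<phi>"
  shows "profinite_digraph G X"
proof -
  let ?A = "arrows G"
  let ?L = "inverse_limit I r F \<phi>" and ?LT = "inverse_limit_topology I r F \<phi>"
  have sys: "finite_inverse_system I r F \<phi>" using lim by (simp add: is_limit_of_def)
  have Ine: "I \<noteq> {}" and po: "partial_order_on I r"
    and dir: "\<And>i j. \<lbrakk>i \<in> I; j \<in> I\<rbrakk> \<Longrightarrow> \<exists>k \<in> I. (i, k) \<in> r \<and> (j, k) \<in> r"
    and fin: "\<And>i. i \<in> I \<Longrightarrow> finite (arrows (F i))"
    using sys unfolding finite_inverse_system_def by blast+
  have rI: "i \<in> I" "j \<in> I" if "(i, j) \<in> r" for i j
    using po that by (auto simp: partial_order_on_def preorder_on_def)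
  have dg: "is_digraph G" and tX: "topspace X = ?A"
    using top by (auto simp: topological_digraph_def)
  have vA: "verts G \<subseteq> ?A" and sv: "\<And>x. x \<in> ?A \<Longrightarrow> src G x \<in> verts G" "\<And>x. x \<in> ?A \<Longrightarrow> tgt G x \<in> verts G"
    and vfix: "\<And>x. x \<in> verts G \<Longrightarrow> src G x = x" "\<And>x. x \<in> verts G \<Longrightarrow> tgt G x = x"
    using dg by (auto simp: is_digraph_def)
  have sA: "\<And>x. x \<in> ?A \<Longrightarrow> src G x \<in> ?A" "\<And>x. x \<in> ?A \<Longrightarrow> tgt G x \<in> ?A" using sv vA by blast+
  obtain f where "topological_digraph_iso G X ?L ?LT f" using lim by (auto simp: is_limit_of_def)
  then have fm: "digraph_map G ?L f" and "homeomorphic_map X ?LT f"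
    by (auto simp: topological_digraph_iso_def)
  then obtain g where fg: "homeomorphic_maps X ?LT f g" using homeomorphic_map_maps by blast
  have tL: "topspace ?LT = arrows ?L"
    by (auto simp: inverse_limit_topology_def inverse_limit_def)
  have cf: "continuous_map X ?LT f" and cg: "continuous_map ?LT X g"
    and gf: "\<And>x. x \<in> ?A \<Longrightarrow> g (f x) = x" and fgy: "\<And>y. y \<in> arrows ?L \<Longrightarrow> f (g y) = y"
    using fg tX tL by (auto simp: homeomorphic_maps_def)
  have gA: "g y \<in> ?A" if "y \<in> arrows ?L" for y
    using cg that tX tL by (metis continuous_map_def PiE)
  have fL: "f x \<in> arrows ?L" if "x \<in> ?A" for x
    using fm that by (auto simp: digraph_map_def)
  have fF: "f x i \<in> arrows (F i)" if "x \<in> ?A" "i \<in> I" for x i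
    using fL[OF that(1)] that(2) by (auto simp: inverse_limit_def)
  have fext: "f x \<in> extensional I" if "x \<in> ?A" for x
    using fL[OF that(1)] by (auto simp: inverse_limit_def PiE_def)
  have fphi: "\<phi> i j (f x j) = f x i" if "x \<in> ?A" "(i, j) \<in> r" for x i j
    using fL[OF that(1)] that(2) by (auto simp: inverse_limit_def)
  have fs: "f (src G x) i = src (F i) (f x i)" "f (tgt G x) i = tgt (F i) (f x i)"
    if "x \<in> ?A" "i \<in> I" for x i
    using fm that by (auto simp: digraph_map_def inverse_limit_def)
  have cfi: "continuous_map X (discrete_topology (arrows (F i))) (\<lambda>x. f x i)" if "i \<in> I" for i
    using cf that unfolding inverse_limit_topology_def continuous_map_in_subtopology
    by (auto simp: continuous_map_componentwise)

  define K where "K i = {(x, y). x \<in> ?A \<and> y \<in> ?A \<and> f x i = f y i}" for i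
  define J where "J = K ` I"
  define q where "q = {(R, S). R \<in> J \<and> S \<in> J \<and> S \<subseteq> R}"
  define p where "p R x = to_nat_on (?A // R) (R `` {x})" for R :: "('a \<times> 'a) set" and x
  define c where "c R = inv_into ?A (p R)" for R
  define H where "H R = \<lparr>arrows = p R ` ?A, verts = p R ` verts G,
      src = (\<lambda>n. p R (src G (c R n))), tgt = (\<lambda>n. p R (tgt G (c R n)))\<rparr>" for R
  define \<psi> where "\<psi> R S n = p R (c S n)" for R S n
  let ?M = "inverse_limit J q H \<psi>" and ?MT = "inverse_limit_topology J q H \<psi>"
  have Kiff: "(x, y) \<in> K i \<longleftrightarrow> x \<in> ?A \<and> y \<in> ?A \<and> f x i = f y i" for x y i by (simp add: K_def)
  have KJ: "K i \<in> J" if "i \<in> I" for i using that by (auto simp: J_def)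
  have eqK: "equiv ?A (K i)" for i
    by (auto simp: K_def equiv_def refl_on_def sym_def trans_def)
  have finK: "finite (?A // K i)" if "i \<in> I" for i
  proof (rule finite_surj[OF fin[OF that]])
    show "?A // K i \<subseteq> (\<lambda>m. {y \<in> ?A. f y i = m}) ` arrows (F i)"
    proof
      fix C assume "C \<in> ?A // K i"
      then obtain x where x: "x \<in> ?A" "C = K i `` {x}" by (rule quotientE)
      then have "C = {y \<in> ?A. f y i = f x i}" by (auto simp: K_def)
      then show "C \<in> (\<lambda>m. {y \<in> ?A. f y i = m}) ` arrows (F i)" using fF x that by blast
    qed
  qed
  have pK: "p (K i) x = p (K i) y \<longleftrightarrow> f x i = f y i" if "i \<in> I" "x \<in> ?A" "y \<in> ?A" for i x y
  proof -
    have "p (K i) x = p (K i) y \<longleftrightarrow> K i `` {x} = K i `` {y}"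
      unfolding p_def using that finK[OF that(1)]
      by (intro inj_on_eq_iff[OF inj_on_to_nat_on]) (auto intro: countable_finite quotientI)
    also have "\<dots> \<longleftrightarrow> (x, y) \<in> K i" using eqK that by (metis eq_equiv_class_iff)
    finally show ?thesis using that by (auto simp: K_def)
  qed
  have cA: "c R n \<in> ?A" and pc: "p R (c R n) = n" if "n \<in> p R ` ?A" for R n
    using that by (auto simp: c_def inv_into_into f_inv_into_f)
  have fc: "f (c (K i) (p (K i) x)) i = f x i" if "i \<in> I" "x \<in> ?A" for i x
    using that pK cA pc by (metis imageI)
  have psi: "\<psi> R S (p S x) = p R x" if asm: "(R, S) \<in> q" "x \<in> ?A" for R S x
  proof -
    obtain i j where ij: "i \<in> I" "j \<in> I" "R = K i" "S = K j" "K j \<subseteq> K i"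
      using asm(1) unfolding q_def J_def by blast
    have cx: "c S (p S x) \<in> ?A" using cA asm(2) by blast
    have "(c S (p S x), x) \<in> K j" using fc[OF ij(2) asm(2)] cx asm(2) ij(4) by (simp add: Kiff)
    then have "(c S (p S x), x) \<in> K i" using ij(5) by blast
    then show ?thesis using pK[OF ij(1) cx asm(2)] ij(3) by (simp add: \<psi>_def Kiff)
  qed
  have psrc: "src (H R) (p R x) = p R (src G x)" "tgt (H R) (p R x) = p R (tgt G x)"
    if asm: "R \<in> J" "x \<in> ?A" for R x
  proof -
    obtain i where i: "i \<in> I" "R = K i" using asm by (auto simp: J_def)
    have cx: "c R (p R x) \<in> ?A" using cA that by blast
    have "f (src G (c R (p R x))) i = f (src G x) i" "f (tgt G (c R (p R x))) i = f (tgt G x) i"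
      using fs fc i that cx by simp_all
    then show "src (H R) (p R x) = p R (src G x)" "tgt (H R) (p R x) = p R (tgt G x)"
      using pK i cx that sA by (simp_all add: H_def)
  qed
  have Kmono: "K j \<subseteq> K i" if "(i, j) \<in> r" for i j
  proof clarify
    fix x y assume "(x, y) \<in> K j"
    then have xy: "x \<in> ?A" "y \<in> ?A" "f x j = f y j" by (simp_all add: Kiff)
    then have "f x i = f y i" using fphi[OF xy(1) that] fphi[OF xy(2) that] by simp
    then show "(x, y) \<in> K i" using xy by (simp add: Kiff)
  qed
  have arrH: "arrows (H R) = p R ` ?A" "verts (H R) = p R ` verts G" for R by (simp_all add: H_def)
  have pfin: "finite (p R ` ?A)" if "R \<in> J" for R
  proof -
    have "p R ` ?A \<subseteq> to_nat_on (?A // R) ` (?A // R)" by (auto simp: p_def intro: quotientI)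
    moreover have "finite (?A // R)" using that finK by (auto simp: J_def)
    ultimately show ?thesis using finite_surj by blast
  qed
  have sysM: "finite_inverse_system J q H \<psi>"
    unfolding finite_inverse_system_def
  proof (intro conjI ballI allI impI)
    show "J \<noteq> {}" using Ine by (simp add: J_def)
    show "partial_order_on J q"
      by (auto simp: partial_order_on_def preorder_on_def refl_on_def trans_def antisym_def q_def)
    show "\<exists>T \<in> J. (R, T) \<in> q \<and> (S, T) \<in> q" if asm: "R \<in> J" "S \<in> J" for R S
    proof -
      obtain i j where ij: "i \<in> I" "j \<in> I" "R = K i" "S = K j" using asm by (auto simp: J_def)
      obtain k where "k \<in> I" "(i, k) \<in> r" "(j, k) \<in> r" using dir ij by blast
      then have "K k \<in> J" "(R, K k) \<in> q" "(S, K k) \<in> q"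
        using Kmono ij KJ by (auto simp: q_def)
      then show ?thesis by blast
    qed
  next
    fix R assume R: "R \<in> J"
    have "src (H R) (p R x) \<in> p R ` verts G" "tgt (H R) (p R x) \<in> p R ` verts G"
      if "x \<in> ?A" for x using psrc[OF R that] sv[OF that] by simp_all
    moreover have "src (H R) (p R x) = p R x" "tgt (H R) (p R x) = p R x"
      if "x \<in> verts G" for x using psrc[OF R] vfix[OF that] vA that by auto
    ultimately show "is_digraph (H R)"
      unfolding is_digraph_def arrH using vA by auto
    show "finite (arrows (H R))" using pfin R by (simp add: arrH)
    fix n assume "n \<in> arrows (H R)"
    then show "\<psi> R R n = n" using pc by (simp add: arrH \<psi>_def)
  next
    fix z assume z: "z \<in> q"
    obtain R S where RS: "z = (R, S)" by (cases z)
    then have "R \<in> J" "S \<in> J" using z by (auto simp: q_def)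
    then have "digraph_map (H S) (H R) (\<psi> R S)"
      unfolding digraph_map_def arrH using z RS psi psrc sA by auto
    then show "case z of (R, S) \<Rightarrow> digraph_map (H S) (H R) (\<psi> R S)" using RS by simp
  next
    fix R S T n assume RST: "(R, S) \<in> q \<and> (S, T) \<in> q" and n: "n \<in> arrows (H T)"
    then have RT: "(R, T) \<in> q" by (auto simp: q_def)
    obtain x where "x \<in> ?A" "n = p T x" using n by (auto simp: arrH)
    then show "\<psi> R S (\<psi> S T n) = \<psi> R T n" using psi RST RT by simp
  qed

  define h where "h x = (\<lambda>R \<in> J. p R x)" for x
  define l where "l n = (\<lambda>i \<in> I. f (c (K i) (n (K i))) i)" for n :: "('a \<times> 'a) set \<Rightarrow> nat"
  have hM: "h x \<in> arrows ?M" if "x \<in> ?A" for x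
  proof -
    have "\<psi> R S (h x S) = h x R" if "(R, S) \<in> q" for R S
    proof -
      have "R \<in> J" "S \<in> J" using that by (auto simp: q_def)
      then show ?thesis using psi[OF that \<open>x \<in> ?A\<close>] by (simp add: h_def)
    qed
    moreover have "h x \<in> (\<Pi>\<^sub>E R \<in> J. arrows (H R))" using that by (simp add: h_def arrH)
    ultimately show ?thesis by (auto simp: inverse_limit_def)
  qed
  have hmap: "digraph_map G ?M h"
    unfolding digraph_map_def
    using hM psrc sA by (auto simp: inverse_limit_def h_def fun_eq_iff)
  have tM: "topspace ?MT = arrows ?M"
    by (auto simp: inverse_limit_topology_def inverse_limit_def)
  have nP: "n R \<in> p R ` ?A" if "n \<in> arrows ?M" "R \<in> J" for n R
    using that by (auto simp: inverse_limit_def arrH)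
  have npsi: "\<psi> R S (n S) = n R" if "n \<in> arrows ?M" "(R, S) \<in> q" for n R S
    using that by (auto simp: inverse_limit_def)
  have nE: "n \<in> extensional J" if "n \<in> arrows ?M" for n
    using that by (auto simp: inverse_limit_def PiE_def)
  have lL: "l n \<in> arrows ?L" if n: "n \<in> arrows ?M" for n
  proof -
    have "\<phi> i j (l n j) = l n i" if "(i, j) \<in> r" for i j
    proof -
      have ij: "i \<in> I" "j \<in> I" using rI that by blast+
      have "(K i, K j) \<in> q" using ij Kmono that KJ by (auto simp: q_def)
      then have 1: "n (K i) = p (K i) (c (K j) (n (K j)))" using npsi n by (simp add: \<psi>_def)
      have 2: "c (K j) (n (K j)) \<in> ?A" using cA nP n KJ ij by blast
      have "\<phi> i j (l n j) = f (c (K j) (n (K j))) i" using fphi 2 that ij by (simp add: l_def)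
      also have "\<dots> = l n i" using 1 2 fc ij by (simp add: l_def)
      finally show ?thesis .
    qed
    moreover have "l n \<in> (\<Pi>\<^sub>E i \<in> I. arrows (F i))"
      using fF cA nP n KJ by (simp add: l_def)
    ultimately show ?thesis by (auto simp: inverse_limit_def)
  qed
  have ch: "continuous_map X ?MT h"
    unfolding inverse_limit_topology_def continuous_map_in_subtopology
  proof (intro conjI)
    show "h \<in> topspace X \<rightarrow> arrows ?M" using hM tX by auto
    have "continuous_map X (discrete_topology (arrows (H R))) (\<lambda>x. h x R)" if R: "R \<in> J" for R
      unfolding continuous_map_def
    proof (intro conjI allI impI)
      show "(\<lambda>x. h x R) \<in> topspace X \<rightarrow> topspace (discrete_topology (arrows (H R)))"
        using R tX by (auto simp: h_def arrH)
      fix U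
      obtain i where i: "i \<in> I" "R = K i" using R by (auto simp: J_def)
      have "{x \<in> topspace X. h x R \<in> U} =
            {x \<in> topspace X. f x i \<in> {f y i | y. y \<in> ?A \<and> p R y \<in> U}}"
        using R i pK tX by (fastforce simp: h_def)
      moreover have "openin X \<dots>"
        by (rule openin_continuous_map_preimage[OF cfi[OF i(1)]]) (use fF i in auto)
      ultimately show "openin X {x \<in> topspace X. h x R \<in> U}" by simp
    qed
    then show "continuous_map X (product_topology (\<lambda>R. discrete_topology (arrows (H R))) J) h"
      by (auto simp: continuous_map_componentwise h_def)
  qed
  have cl: "continuous_map ?MT ?LT l"
    unfolding inverse_limit_topology_def[of I] continuous_map_in_subtopology
  proof (intro conjI)
    show "l \<in> topspace ?MT \<rightarrow> arrows ?L" using lL tM by auto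
    have "continuous_map ?MT (discrete_topology (arrows (F i))) (\<lambda>n. l n i)" if i: "i \<in> I" for i
    proof -
      have 1: "continuous_map ?MT (discrete_topology (arrows (H (K i)))) (\<lambda>n. n (K i))"
        unfolding inverse_limit_topology_def using KJ[OF i]
        by (intro continuous_map_from_subtopology continuous_map_product_projection)
      have 2: "continuous_map (discrete_topology (arrows (H (K i)))) (discrete_topology (arrows (F i)))
          (\<lambda>m. f (c (K i) m) i)"
        using fF cA i by (auto simp: arrH)
      show ?thesis using continuous_map_compose[OF 1 2] i by (simp add: l_def o_def)
    qed
    then show "continuous_map ?MT (product_topology (\<lambda>i. discrete_topology (arrows (F i))) I) l"
      by (auto simp: continuous_map_componentwise l_def)
  qed
  have "homeomorphic_maps X ?MT h (g \<circ> l)"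
    unfolding homeomorphic_maps_def tX tM
  proof (intro conjI ballI)
    show "continuous_map X ?MT h" by (rule ch)
    show "continuous_map ?MT X (g \<circ> l)" using continuous_map_compose[OF cl cg] .
    fix x assume x: "x \<in> ?A"
    have "l (h x) = f x"
    proof (rule extensionalityI[OF _ fext[OF x]])
      show "l (h x) \<in> extensional I" by (simp add: l_def)
      show "l (h x) i = f x i" if "i \<in> I" for i using that fc x KJ by (simp add: l_def h_def)
    qed
    then show "(g \<circ> l) (h x) = x" using gf x by simp
  next
    fix n assume n: "n \<in> arrows ?M"
    let ?y = "g (l n)"
    have y: "?y \<in> ?A" "f ?y = l n" using gA fgy lL n by auto
    have "h ?y = n"
    proof (rule extensionalityI[OF _ nE[OF n]])
      show "h ?y \<in> extensional J" by (simp add: h_def)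
      fix R assume R: "R \<in> J"
      then obtain i where i: "i \<in> I" "R = K i" by (auto simp: J_def)
      have "f ?y i = f (c R (n R)) i" using y i by (simp add: l_def)
      then have "p R ?y = p R (c R (n R))" using pK i y cA nP n R by simp
      then show "h ?y R = n R" using pc nP n R by (simp add: h_def)
    qed
    then show "h ((g \<circ> l) n) = n" by simp
  qed
  then have "homeomorphic_map X ?MT h" using homeomorphic_map_maps by blast
  then have "is_limit_of G X J q H \<psi>"
    unfolding is_limit_of_def topological_digraph_iso_def using sysM hmap by blast
  then show ?thesis unfolding profinite_digraph_def using top by blast
qed

end

theory Submission
  imports Defs
begin

text \<open>
  If \<open>\<Gamma>\<close> is the limit of finite directed graphs, the kernels of its projections are cofinite
  entourages that are closed, directed and intersect in the diagonal; by compactness of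
  \<open>\<Gamma> \<times> \<Gamma>\<close> each neighbourhood of the diagonal contains one of them. Conversely, if the cofinite
  entourages are a base, then they separate points and make source and target continuous, and
  \<open>\<Gamma>\<close> maps bijectively (by compactness, applied to threads of clopen classes) and hence
  homeomorphically onto the limit of its finite quotients \<open>\<Gamma>/R\<close>.
\<close>

section \<open>Kernels of finite projections\<close>

text \<open>\<open>K\<close> is the preimage of the diagonal of \<open>B\<close> under
  \<open>f\<close> paired with itself, and every subset of a discrete space is clopen.\<close>

lemma openin_closedin_discrete_pair_preimage:
  assumes "continuous_map X (discrete_topology B) f"
  defines "K \<equiv> {(x, y). x \<in> topspace X \<and> y \<in> topspace X \<and> f x = f y}"
  shows "openin (prod_topology X X) K" "closedin (prod_topology X X) K"
proof -
  have fB: "f x \<in> B" if "x \<in> topspace X" for x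
    using assms(1) that by (auto simp: continuous_map_def)
  have cont: "continuous_map (prod_topology X X) (discrete_topology (B \<times> B)) (\<lambda>(x, y). (f x, f y))"
    using assms(1) by (simp add: prod_topology_discrete_topology continuous_map_prod_top)
  have K: "K = {z \<in> topspace (prod_topology X X). (\<lambda>(x, y). (f x, f y)) z \<in> Id_on B}"
    using fB by (auto simp: K_def)
  show "openin (prod_topology X X) K" unfolding K
    by (rule openin_continuous_map_preimage[OF cont]) auto
  show "closedin (prod_topology X X) K" unfolding K
    by (rule closedin_continuous_map_preimage[OF cont]) auto
qed

text \<open>Every class is the fibre of \<open>f\<close> over a point of \<open>B\<close>, so there
  are at most as many classes as points.\<close>

lemma finite_quotient_kernel:
  assumes "finite B" "f \<in> A \<rightarrow> B"
  shows "finite (A // {(x, y). x \<in> A \<and> y \<in> A \<and> f x = f y})"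
proof (rule finite_surj[OF assms(1)])
  show "A // {(x, y). x \<in> A \<and> y \<in> A \<and> f x = f y} \<subseteq> (\<lambda>m. {y \<in> A. f y = m}) ` B"
  proof
    fix C assume "C \<in> A // {(x, y). x \<in> A \<and> y \<in> A \<and> f x = f y}"
    then obtain x where "x \<in> A" "C = {(x, y). x \<in> A \<and> y \<in> A \<and> f x = f y} `` {x}"
      by (rule quotientE)
    then have "f x \<in> B" "C = {y \<in> A. f y = f x}" using assms(2) by auto
    then show "C \<in> (\<lambda>m. {y \<in> A. f y = m}) ` B" by blast
  qed
qed

text \<open>The entourages come from the coordinates of a homeomorphism onto the limit: continuity
  makes their kernels clopen, finiteness of \<open>F i\<close> bounds the index, and commutation
  with source and target gives compatibility.\<close>

lemma profinite_imp_cofinite_base: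
  assumes "compact_space X" and prof: "profinite_digraph G X"
  shows "is_uniformity_base {R. cofinite_entourage G (diagonal_nhds X) R} (diagonal_nhds X)"
proof -
  let ?A = "arrows G"
  let ?XX = "prod_topology X X"
  obtain I :: "('a \<times> 'a) set set" and r and F :: "('a \<times> 'a) set \<Rightarrow> nat digraph" and \<phi>
    where top: "topological_digraph G X" and lim: "is_limit_of G X I r F \<phi>"
    using prof unfolding profinite_digraph_def by blast
  let ?L = "inverse_limit I r F \<phi>" and ?LT = "inverse_limit_topology I r F \<phi>"
  have Ine: "I \<noteq> {}" and po: "partial_order_on I r"
    and dir: "\<And>i j. \<lbrakk>i \<in> I; j \<in> I\<rbrakk> \<Longrightarrow> \<exists>k \<in> I. (i, k) \<in> r \<and> (j, k) \<in> r"
    and fin: "\<And>i. i \<in> I \<Longrightarrow> finite (arrows (F i))"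
    using lim unfolding is_limit_of_def finite_inverse_system_def by blast+
  have sA: "src G x \<in> ?A" "tgt G x \<in> ?A" if "x \<in> ?A" for x
    using top that by (auto simp: topological_digraph_def is_digraph_def)
  have tX: "topspace X = ?A" using top by (simp add: topological_digraph_def)
  obtain f where fm: "digraph_map G ?L f" and fh: "homeomorphic_map X ?LT f"
    using lim by (auto simp: is_limit_of_def topological_digraph_iso_def)
  have fL: "f x \<in> arrows ?L" if "x \<in> ?A" for x
    using fm that by (auto simp: digraph_map_def)
  have fF: "f x i \<in> arrows (F i)" if "x \<in> ?A" "i \<in> I" for x i
    using fL[OF that(1)] that(2) by (auto simp: inverse_limit_def)
  have fs: "f (src G x) i = src (F i) (f x i)" "f (tgt G x) i = tgt (F i) (f x i)"
    if "x \<in> ?A" "i \<in> I" for x i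
    using fm that by (auto simp: digraph_map_def inverse_limit_def)
  have cfi: "continuous_map X (discrete_topology (arrows (F i))) (\<lambda>x. f x i)" if "i \<in> I" for i
    using homeomorphic_imp_continuous_map[OF fh] that
    unfolding inverse_limit_topology_def continuous_map_in_subtopology
    by (auto simp: continuous_map_componentwise)
  define K where "K i = {(x, y). x \<in> topspace X \<and> y \<in> topspace X \<and> f x i = f y i}" for i
  have Kop: "openin ?XX (K i)" and Kcl: "closedin ?XX (K i)" if "i \<in> I" for i
    unfolding K_def using openin_closedin_discrete_pair_preimage[OF cfi[OF that]] by auto
  \<comment> \<open>Coordinate \<open>i\<close> of a thread is determined by coordinate
    \<open>j\<close> through the transition map.\<close>
  have Kmono: "K j \<subseteq> K i" if "(i, j) \<in> r" for i j
  proof -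
    have "\<phi> i j (f x j) = f x i" if "x \<in> ?A" for x
      using fL[OF that] \<open>(i, j) \<in> r\<close> by (auto simp: inverse_limit_def)
    then show ?thesis by (clarsimp simp: K_def tX) metis
  qed
  have Kdiag: "K i \<in> diagonal_nhds X" if "i \<in> I" for i
    using Kop[OF that] by (auto simp: diagonal_nhds_def K_def Id_on_def)
  have Kcof: "cofinite_entourage G (diagonal_nhds X) (K i)" if i: "i \<in> I" for i
    unfolding cofinite_entourage_def compatible_equiv_def
  proof (intro conjI)
    show "equiv ?A (K i)" by (auto simp: K_def tX equiv_def refl_on_def sym_def trans_def)
    show "\<forall>(x, y) \<in> K i. (src G x, src G y) \<in> K i \<and> (tgt G x, tgt G y) \<in> K i"
      using fs i sA by (auto simp: K_def tX)
    show "finite (?A // K i)" unfolding K_def tX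
      by (rule finite_quotient_kernel[OF fin[OF i]]) (use fF i in auto)
  qed (rule Kdiag[OF i])
  have sep: "x = y" if "x \<in> ?A" "y \<in> ?A" "\<And>i. i \<in> I \<Longrightarrow> (x, y) \<in> K i" for x y
  proof -
    have "f x i = f y i" if "i \<in> I" for i using \<open>\<And>i. i \<in> I \<Longrightarrow> (x, y) \<in> K i\<close>[OF that] by (simp add: K_def)
    moreover have "f x \<in> extensional I" "f y \<in> extensional I"
      using fL that by (auto simp: inverse_limit_def PiE_def)
    ultimately have "f x = f y" by (intro extensionalityI)
    then show ?thesis using homeomorphic_imp_injective_map[OF fh] that tX by (auto simp: inj_on_def)
  qed
  have "\<exists>i \<in> I. K i \<subseteq> U" if U: "U \<in> diagonal_nhds X" for U
  proof -
    obtain W where W: "openin ?XX W" "Id_on ?A \<subseteq> W" "W \<subseteq> U"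
      using U unfolding diagonal_nhds_def tX by blast
    \<comment> \<open>By \<open>sep\<close>, the complements of the kernels cover everything off the
      diagonal. \<open>W\<close> is built into each member, so a finite subcover is indexed by a
      finite subset of \<open>I\<close>.\<close>
    let ?V = "\<lambda>i. W \<union> (topspace ?XX - K i)"
    have "compact_space ?XX" using assms(1) by (simp add: compact_space_prod_topology)
    moreover have "\<forall>V \<in> ?V ` I. openin ?XX V" using W Kcl by blast
    moreover have "topspace ?XX \<subseteq> \<Union> (?V ` I)"
    proof
      fix z assume z: "z \<in> topspace ?XX"
      then obtain x y where xy: "z = (x, y)" "x \<in> ?A" "y \<in> ?A" using tX by auto
      obtain i where "i \<in> I" using Ine by blast
      show "z \<in> \<Union> (?V ` I)"
      proof (cases "x = y")
        case True
        then show ?thesis using xy W \<open>i \<in> I\<close> by auto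
      next
        case False
        then show ?thesis using sep xy z by blast
      qed
    qed
    ultimately obtain \<F> where \<F>: "finite \<F>" "\<F> \<subseteq> ?V ` I" "topspace ?XX \<subseteq> \<Union> \<F>"
      unfolding compact_space_alt by meson
    obtain T where T: "T \<subseteq> I" "finite T" "\<F> = ?V ` T"
      using finite_subset_image[OF \<F>(1,2)] by blast
    \<comment> \<open>Directedness of \<open>I\<close> replaces finitely many kernels by a single
      finer one.\<close>
    have "\<exists>k \<in> I. \<forall>i \<in> T. K k \<subseteq> K i" using T(2,1)
    proof (induction T)
      case empty
      then show ?case using Ine by auto
    next
      case (insert j T)
      then obtain k where k: "k \<in> I" "\<forall>i \<in> T. K k \<subseteq> K i" by auto
      obtain l where "l \<in> I" "(j, l) \<in> r" "(k, l) \<in> r" using dir[of j k] insert k by auto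
      then show ?case using k Kmono by (metis insert_iff order_trans)
    qed
    then obtain k where k: "k \<in> I" "\<And>i. i \<in> T \<Longrightarrow> K k \<subseteq> K i" by blast
    \<comment> \<open>A point of \<open>K k\<close> lies in no complement of \<open>K i\<close> with
      \<open>i\<close> in \<open>T\<close>, so the subcover can only catch it through
      \<open>W\<close>.\<close>
    have "K k \<subseteq> W"
    proof
      fix z assume z: "z \<in> K k"
      then have "z \<in> topspace ?XX" by (auto simp: K_def)
      then show "z \<in> W" using \<F>(3) T(3) k(2) z by blast
    qed
    then show ?thesis using k W by blast
  qed
  then have "\<exists>B \<in> {R. cofinite_entourage G (diagonal_nhds X) R}. B \<subseteq> U"
    if "U \<in> diagonal_nhds X" for U
    using Kcof that by blast
  then show ?thesis by (auto simp: is_uniformity_base_def cofinite_entourage_def)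
qed


section \<open>Finite quotients\<close>

text \<open>Source and target of a class are saturated images, which avoids choosing
  representatives; for compatible \<open>R\<close> they are again single classes.\<close>

definition quotient_digraph :: "'a digraph \<Rightarrow> ('a \<times> 'a) set \<Rightarrow> 'a set digraph" where
  "quotient_digraph G R =
     \<lparr>arrows = arrows G // R,
      verts = (\<lambda>x. R `` {x}) ` verts G,
      src = (\<lambda>C. R `` (src G ` C)),
      tgt = (\<lambda>C. R `` (tgt G ` C))\<rparr>"

text \<open>This identifies saturation by \<open>R\<close> as the natural projection from
  \<open>S\<close>-classes to \<open>R\<close>-classes, which will serve as transition map.\<close>

lemma equiv_Image_class:
  assumes "equiv A R" "equiv A S" "S \<subseteq> R" "x \<in> A"
  shows "R `` (S `` {x}) = R `` {x}"
  using assms by (auto simp: equiv_def refl_on_def dest: transD)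

text \<open>Compatibility puts the sources of all members of a class into one class, and likewise
  the targets.\<close>

lemma quotient_digraph_class:
  assumes "compatible_equiv G R" "x \<in> arrows G"
  shows "src (quotient_digraph G R) (R `` {x}) = R `` {src G x}"
    "tgt (quotient_digraph G R) (R `` {x}) = R `` {tgt G x}"
proof -
  have eq: "equiv (arrows G) R"
    and comp: "\<And>y. (x, y) \<in> R \<Longrightarrow> (src G x, src G y) \<in> R \<and> (tgt G x, tgt G y) \<in> R"
    using assms(1) by (auto simp: compatible_equiv_def)
  have "(x, x) \<in> R" "trans R" using eq assms(2) by (auto simp: equiv_def refl_on_def)
  then show "src (quotient_digraph G R) (R `` {x}) = R `` {src G x}"
    "tgt (quotient_digraph G R) (R `` {x}) = R `` {tgt G x}"
    using comp by (auto simp: quotient_digraph_def dest: transD)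
qed

lemma is_digraph_quotient:
  assumes "is_digraph G" "compatible_equiv G R"
  shows "is_digraph (quotient_digraph G R)"
proof -
  let ?Q = "quotient_digraph G R"
  have vA: "verts G \<subseteq> arrows G"
    and sv: "\<And>x. x \<in> arrows G \<Longrightarrow> src G x \<in> verts G \<and> tgt G x \<in> verts G"
    and vfix: "\<And>x. x \<in> verts G \<Longrightarrow> src G x = x \<and> tgt G x = x"
    using assms(1) by (auto simp: is_digraph_def)
  have arr: "arrows ?Q = (\<lambda>x. R `` {x}) ` arrows G" and ver: "verts ?Q = (\<lambda>x. R `` {x}) ` verts G"
    by (auto simp: quotient_digraph_def quotient_def)
  show ?thesis unfolding is_digraph_def arr ver
  proof (intro conjI ballI)
    show "(\<lambda>x. R `` {x}) ` verts G \<subseteq> (\<lambda>x. R `` {x}) ` arrows G" using vA by blast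
    show "src ?Q \<in> (\<lambda>x. R `` {x}) ` arrows G \<rightarrow> (\<lambda>x. R `` {x}) ` verts G"
      "tgt ?Q \<in> (\<lambda>x. R `` {x}) ` arrows G \<rightarrow> (\<lambda>x. R `` {x}) ` verts G"
      using sv quotient_digraph_class[OF assms(2)] by auto
    fix C assume "C \<in> (\<lambda>x. R `` {x}) ` verts G"
    then show "src ?Q C = C" "tgt ?Q C = C"
      using vA vfix quotient_digraph_class[OF assms(2)] by auto
  qed
qed

lemma digraph_map_quotient:
  assumes "is_digraph G" "compatible_equiv G R" "compatible_equiv G S" "S \<subseteq> R"
  shows "digraph_map (quotient_digraph G S) (quotient_digraph G R) (\<lambda>C. R `` C)"
proof -
  have arr: "arrows (quotient_digraph G R) = (\<lambda>x. R `` {x}) ` arrows G" for R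
    by (auto simp: quotient_digraph_def quotient_def)
  have cl: "R `` (S `` {x}) = R `` {x}" if "x \<in> arrows G" for x
    using assms that by (intro equiv_Image_class[of "arrows G"]) (auto simp: compatible_equiv_def)
  have "src G x \<in> arrows G \<and> tgt G x \<in> arrows G" if "x \<in> arrows G" for x
    using assms(1) that by (auto simp: is_digraph_def)
  then show ?thesis
    unfolding digraph_map_def arr
    using cl quotient_digraph_class[OF assms(2)] quotient_digraph_class[OF assms(3)] by auto
qed

text \<open>A class of the intersection is an \<open>R\<close>-class met with an
  \<open>S\<close>-class, which leaves finitely many. The result makes the index set of the
  quotients directed.\<close>

lemma cofinite_entourage_Int:
  assumes "is_uniformity A \<U>" "cofinite_entourage G \<U> R" "cofinite_entourage G \<U> S"
  shows "cofinite_entourage G \<U> (R \<inter> S)"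
  unfolding cofinite_entourage_def
proof (intro conjI)
  show "compatible_equiv G (R \<inter> S)"
    using assms(2,3) by (auto simp: cofinite_entourage_def compatible_equiv_def equiv_def
        refl_on_def intro: sym_Int trans_Int)
  have "arrows G // (R \<inter> S) \<subseteq> (\<lambda>(C, D). C \<inter> D) ` ((arrows G // R) \<times> (arrows G // S))"
  proof
    fix C assume "C \<in> arrows G // (R \<inter> S)"
    then obtain x where x: "x \<in> arrows G" "C = (R \<inter> S) `` {x}" by (rule quotientE)
    then have "C = R `` {x} \<inter> S `` {x}" by blast
    moreover have "(R `` {x}, S `` {x}) \<in> (arrows G // R) \<times> (arrows G // S)"
      using x by (simp add: quotientI)
    ultimately show "C \<in> (\<lambda>(C, D). C \<inter> D) ` ((arrows G // R) \<times> (arrows G // S))"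
      by (simp add: image_iff) blast
  qed
  moreover have "finite ((arrows G // R) \<times> (arrows G // S))"
    using assms(2,3) by (simp add: cofinite_entourage_def)
  ultimately show "finite (arrows G // (R \<inter> S))" by (rule finite_surj[rotated])
  show "R \<inter> S \<in> \<U>"
    using assms unfolding cofinite_entourage_def is_uniformity_def by blast
qed

section \<open>Topology and continuity from cofinite entourages\<close>

lemma induces_topologyD:
  assumes "induces_topology \<U> X" "openin X S" "x \<in> S"
  obtains U where "U \<in> \<U>" "U `` {x} \<subseteq> S"
  using assms(1)[unfolded induces_topology_def, THEN spec, of S] assms(2,3) by auto

text \<open>By transitivity a class contains the class of each of its members, so it is a
  neighbourhood of all its points.\<close>

lemma openin_entourage_class:
  assumes "induces_topology \<U> X" "R \<in> \<U>" "equiv (topspace X) R"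
  shows "openin X (R `` {x})"
proof -
  have "R `` {x} \<subseteq> topspace X" using assms(3) by (auto dest: equiv_type)
  moreover have "R `` {y} \<subseteq> R `` {x}" if "y \<in> R `` {x}" for y
    using assms(3) that by (auto simp: equiv_def dest: transD)
  ultimately show ?thesis using assms(1,2) unfolding induces_topology_def by blast
qed

text \<open>In effect \<open>h\<close> is uniformly continuous: it preserves every basic
  \<open>R\<close>, hence maps \<open>R\<close>-classes into \<open>R\<close>-classes. It will be
  \<open>src G\<close> or \<open>tgt G\<close>.\<close>

lemma continuous_map_cofinite_base:
  assumes tX: "topspace X = arrows G" and ind: "induces_topology \<U> X"
    and base: "\<And>U. U \<in> \<U> \<Longrightarrow> \<exists>R. cofinite_entourage G \<U> R \<and> R \<subseteq> U"
    and h: "h \<in> arrows G \<rightarrow> arrows G"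
    and comp: "\<And>R x y. \<lbrakk>cofinite_entourage G \<U> R; (x, y) \<in> R\<rbrakk> \<Longrightarrow> (h x, h y) \<in> R"
  shows "continuous_map X X h"
  unfolding continuous_map_def
proof (intro conjI allI impI)
  show "h \<in> topspace X \<rightarrow> topspace X" using h tX by simp
  fix S assume "openin X S"
  have "\<exists>U \<in> \<U>. U `` {x} \<subseteq> {x \<in> topspace X. h x \<in> S}" if x: "x \<in> topspace X" "h x \<in> S" for x
  proof -
    obtain U where "U \<in> \<U>" "U `` {h x} \<subseteq> S"
      using induces_topologyD[OF ind \<open>openin X S\<close> x(2)] by blast
    then obtain R where R: "cofinite_entourage G \<U> R" "R `` {h x} \<subseteq> S" using base by blast
    then have "R \<subseteq> topspace X \<times> topspace X"
      using tX by (simp add: cofinite_entourage_def compatible_equiv_def equiv_type)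
    then have "R `` {x} \<subseteq> {x \<in> topspace X. h x \<in> S}" using R comp by blast
    then show ?thesis using R(1) unfolding cofinite_entourage_def by blast
  qed
  then show "openin X {x \<in> topspace X. h x \<in> S}"
    using ind unfolding induces_topology_def by auto
qed

lemma cofinite_base_imp_topological_digraph:
  assumes dg: "is_digraph G" and tX: "topspace X = arrows G" and ind: "induces_topology \<U> X"
    and base: "\<And>U. U \<in> \<U> \<Longrightarrow> \<exists>R. cofinite_entourage G \<U> R \<and> R \<subseteq> U"
  shows "topological_digraph G X"
proof -
  have sv: "src G \<in> arrows G \<rightarrow> verts G" "tgt G \<in> arrows G \<rightarrow> verts G" and "verts G \<subseteq> arrows G"
    using dg by (auto simp: is_digraph_def)
  then have "src G \<in> arrows G \<rightarrow> arrows G" "tgt G \<in> arrows G \<rightarrow> arrows G" by blast+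
  then have "continuous_map X X (src G)" "continuous_map X X (tgt G)"
    by (auto intro!: continuous_map_cofinite_base[OF tX ind base]
        simp: cofinite_entourage_def compatible_equiv_def)
  then show ?thesis
    using dg tX sv by (simp add: topological_digraph_def continuous_map_in_subtopology)
qed

section \<open>Reconstruction as the limit of the finite quotients\<close>

lemma cofinite_base_imp_profinite:
  assumes dg: "is_digraph G" and tX: "topspace X = arrows G"
    and cX: "compact_space X" and hX: "Hausdorff_space X"
    and unif: "is_uniformity (topspace X) \<U>" and ind: "induces_topology \<U> X"
    and ub: "is_uniformity_base {R. cofinite_entourage G \<U> R} \<U>"
  shows "profinite_digraph G X"
proof -
  let ?A = "arrows G"
  define I where "I = {R. cofinite_entourage G \<U> R}"
  \<comment> \<open>Reverse inclusion: finer relations are higher, transition maps coarsen classes,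
    and intersections are upper bounds.\<close>
  define r where "r = {(R, S). R \<in> I \<and> S \<in> I \<and> S \<subseteq> R}"
  define F where "F = quotient_digraph G"
  define \<phi> where "\<phi> R S C = R `` C" for R S :: "('a \<times> 'a) set" and C
  let ?L = "inverse_limit I r F \<phi>" and ?LT = "inverse_limit_topology I r F \<phi>"
  have base: "\<exists>R. cofinite_entourage G \<U> R \<and> R \<subseteq> U" if "U \<in> \<U>" for U
    using ub that unfolding is_uniformity_base_def by blast
  have top: "topological_digraph G X"
    by (rule cofinite_base_imp_topological_digraph[OF dg tX ind base])
  have comp: "compatible_equiv G R" and eqv: "equiv ?A R" and finq: "finite (?A // R)"
    and RU: "R \<in> \<U>" if "R \<in> I" for R
    using that by (auto simp: I_def cofinite_entourage_def compatible_equiv_def)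
  have "\<U> \<noteq> {}" using unif by (simp add: is_uniformity_def)
  then have Ine: "I \<noteq> {}" using base unfolding I_def by blast
  have Int: "R \<inter> S \<in> I" if "R \<in> I" "S \<in> I" for R S
    using cofinite_entourage_Int[OF unif] that by (simp add: I_def)
  have cl: "R `` (S `` {x}) = R `` {x}" if "(R, S) \<in> r" "x \<in> ?A" for R S x
    using that eqv by (intro equiv_Image_class[of ?A]) (auto simp: r_def)
  have arr: "arrows (F R) = (\<lambda>x. R `` {x}) ` ?A" for R
    by (auto simp: F_def quotient_digraph_def quotient_def)
  have sys: "finite_inverse_system I r F \<phi>"
    unfolding finite_inverse_system_def
  proof (intro conjI ballI allI impI)
    show "I \<noteq> {}" by (rule Ine)
    show "partial_order_on I r"
      by (auto simp: partial_order_on_def preorder_on_def refl_on_def trans_def antisym_def r_def)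
    show "\<exists>T \<in> I. (R, T) \<in> r \<and> (S, T) \<in> r" if "R \<in> I" "S \<in> I" for R S
      using Int[OF that] that by (auto simp: r_def)
    show "is_digraph (F R)" if "R \<in> I" for R
      using is_digraph_quotient[OF dg comp[OF that]] by (simp add: F_def)
    show "finite (arrows (F R))" if "R \<in> I" for R
      using finq[OF that] by (simp add: F_def quotient_digraph_def)
    show "case z of (R, S) \<Rightarrow> digraph_map (F S) (F R) (\<phi> R S)" if "z \<in> r" for z
      using that digraph_map_quotient[OF dg] comp by (auto simp: r_def F_def \<phi>_def[abs_def])
    show "\<phi> R R C = C" if "R \<in> I" "C \<in> arrows (F R)" for R C
      using that cl[of R R] by (auto simp: \<phi>_def arr r_def)
    show "\<phi> R S (\<phi> S T C) = \<phi> R T C"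
      if RST: "(R, S) \<in> r \<and> (S, T) \<in> r" and C: "C \<in> arrows (F T)" for R S T C
    proof -
      have "(R, T) \<in> r" using RST by (auto simp: r_def)
      moreover obtain x where "x \<in> ?A" "C = T `` {x}" using C by (auto simp: arr)
      ultimately show ?thesis using RST by (simp add: \<phi>_def cl)
    qed
  qed
  define f where "f x = (\<lambda>R \<in> I. R `` {x})" for x :: 'a
  have fL: "f x \<in> arrows ?L" if "x \<in> ?A" for x
  proof -
    have "\<phi> R S (f x S) = f x R" if "(R, S) \<in> r" for R S
      using cl[OF that \<open>x \<in> ?A\<close>] that by (auto simp: \<phi>_def f_def r_def)
    moreover have "f x \<in> (\<Pi>\<^sub>E R \<in> I. arrows (F R))" using that by (simp add: f_def arr)
    ultimately show ?thesis by (auto simp: inverse_limit_def)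
  qed
  have tL: "topspace ?LT = arrows ?L"
    by (auto simp: inverse_limit_topology_def inverse_limit_def)
  have fm: "digraph_map G ?L f"
    unfolding digraph_map_def
  proof (intro conjI ballI)
    show "f \<in> ?A \<rightarrow> arrows ?L" using fL by blast
    fix x assume "x \<in> ?A"
    then show "f (src G x) = src ?L (f x)" "f (tgt G x) = tgt ?L (f x)"
      using quotient_digraph_class[OF comp]
      by (auto simp: inverse_limit_def f_def F_def fun_eq_iff restrict_def)
  qed
  have opc: "openin X (R `` {x})" if "R \<in> I" for R x
    using openin_entourage_class[OF ind RU] eqv that tX by simp
  have cf: "continuous_map X ?LT f"
    unfolding inverse_limit_topology_def continuous_map_in_subtopology
  proof (intro conjI)
    show "f \<in> topspace X \<rightarrow> arrows ?L" using fL tX by auto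
    have "continuous_map X (discrete_topology (arrows (F R))) (\<lambda>x. f x R)" if R: "R \<in> I" for R
      unfolding continuous_map_def
    proof (intro conjI allI impI)
      show "(\<lambda>x. f x R) \<in> topspace X \<rightarrow> topspace (discrete_topology (arrows (F R)))"
        using R tX by (auto simp: f_def arr)
      fix \<C>
      \<comment> \<open>The coordinate at \<open>R\<close> is constant on the open class of
        \<open>x\<close>, hence locally constant.\<close>
      have "\<exists>T. openin X T \<and> x \<in> T \<and> T \<subseteq> {x \<in> topspace X. f x R \<in> \<C>}"
        if "x \<in> topspace X" "f x R \<in> \<C>" for x
      proof (intro exI conjI)
        show "openin X (R `` {x})" by (rule opc[OF R])
        show "x \<in> R `` {x}" using equiv_class_self[OF eqv[OF R]] that tX by simp
        have "R `` {y} = R `` {x}" "y \<in> ?A" if "(x, y) \<in> R" for y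
          using eqv[OF R] that by (auto simp: equiv_class_eq_iff)
        then show "R `` {x} \<subseteq> {x \<in> topspace X. f x R \<in> \<C>}"
          using that R tX by (auto simp: f_def)
      qed
      then show "openin X {x \<in> topspace X. f x R \<in> \<C>}"
        by (subst openin_subopen) blast
    qed
    then show "continuous_map X (product_topology (\<lambda>R. discrete_topology (arrows (F R))) I) f"
      by (auto simp: continuous_map_componentwise f_def)
  qed
  \<comment> \<open>The values of a thread are themselves subsets of the space, and any point common
    to all of them is a preimage. Such a point exists because they are nonempty, closed and directed
    downwards.\<close>
  have surj: "\<exists>x \<in> ?A. f x = c" if c: "c \<in> arrows ?L" for c
  proof -
    have cR: "c R \<in> (\<lambda>x. R `` {x}) ` ?A" if "R \<in> I" for R
      using c that by (auto simp: inverse_limit_def arr)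
    have cne: "c R \<noteq> {}" "c R \<subseteq> ?A" if "R \<in> I" for R
      using cR[OF that] eqv[OF that] by (auto dest: equiv_class_self equiv_type)
    have cmono: "c S \<subseteq> c R" if "(R, S) \<in> r" for R S
    proof -
      have "S \<in> I" using that by (simp add: r_def)
      \<comment> \<open>Reflexivity puts \<open>c S\<close> inside its saturation, which the thread
        condition identifies with \<open>c R\<close>.\<close>
      then have "c S \<subseteq> R `` c S"
        using cne(2) eqv[of R] that by (fastforce simp: r_def equiv_def refl_on_def)
      moreover have "\<phi> R S (c S) = c R" using c that by (auto simp: inverse_limit_def)
      ultimately show ?thesis by (simp add: \<phi>_def)
    qed
    have ccl: "closedin X (c R)" if R: "R \<in> I" for R
    proof -
      obtain x where x: "x \<in> ?A" "c R = R `` {x}" using cR[OF R] by blast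
      \<comment> \<open>The complement of a class is the union of the other classes, all of them
        open.\<close>
      have "?A - R `` {x} = (\<Union>y \<in> ?A - R `` {x}. R `` {y})"
        using eqv[OF R] by (auto simp: equiv_def refl_on_def dest: transD symD)
      then have "openin X (?A - R `` {x})" using opc[OF R] by (metis (no_types, lifting) openin_Union imageE)
      then show ?thesis using x cne(2)[OF R] tX by (simp add: closedin_def)
    qed
    \<comment> \<open>This yields the finite intersection property, since \<open>c S\<close> is
      nonempty.\<close>
    have fip: "\<exists>S \<in> I. \<forall>R \<in> T. c S \<subseteq> c R" if "finite T" "T \<subseteq> I" for T
      using that
    proof (induction T)
      case empty
      then show ?case using Ine by auto
    next
      case (insert R T)
      then obtain S where S: "S \<in> I" "\<forall>R \<in> T. c S \<subseteq> c R" by auto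
      have "(R, R \<inter> S) \<in> r" "(S, R \<inter> S) \<in> r" "R \<inter> S \<in> I" using Int insert S by (auto simp: r_def)
      then show ?case using S cmono by (metis insert_iff order_trans)
    qed
    have "\<Inter> (c ` I) \<noteq> {}"
    proof (rule cX[unfolded compact_space_fip, rule_format], intro conjI ballI allI impI)
      show "closedin X C" if "C \<in> c ` I" for C using that ccl by blast
      fix \<F> assume "finite \<F> \<and> \<F> \<subseteq> c ` I"
      then obtain T where "T \<subseteq> I" "finite T" "\<F> = c ` T" using finite_subset_image by metis
      then obtain S where "S \<in> I" "c S \<subseteq> \<Inter> \<F>" using fip by (metis INT_greatest)
      then show "\<Inter> \<F> \<noteq> {}" using cne by blast
    qed
    then obtain x where x: "\<And>R. R \<in> I \<Longrightarrow> x \<in> c R" by blast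
    have xA: "x \<in> ?A" using x cne Ine by blast
    have "f x = c"
    proof (rule extensionalityI[of _ I])
      show "f x \<in> extensional I" by (simp add: f_def)
      show "c \<in> extensional I" using c by (auto simp: inverse_limit_def PiE_def)
      fix R assume R: "R \<in> I"
      obtain y where "y \<in> ?A" "c R = R `` {y}" using cR[OF R] by blast
      then show "f x R = c R" using x[OF R] R equiv_class_eq[OF eqv[OF R]] by (auto simp: f_def)
    qed
    then show ?thesis using xA by blast
  qed
  \<comment> \<open>A basic entourage whose class at \<open>x\<close> stays inside an open set
    missing \<open>y\<close> cannot relate \<open>x\<close> to \<open>y\<close>.\<close>
  have inj: "inj_on f ?A"
  proof (rule inj_onI, rule ccontr)
    fix x y assume xy: "x \<in> ?A" "y \<in> ?A" "f x = f y" "x \<noteq> y"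
    then have "x \<in> topspace X" "y \<in> topspace X" by (simp_all add: tX)
    then obtain S T where "openin X S" "x \<in> S" "y \<in> T" "disjnt S T"
      using hX xy(4) unfolding Hausdorff_space_def by metis
    then have S: "openin X S" "x \<in> S" "y \<notin> S" by (auto simp: disjnt_def)
    then obtain U where "U \<in> \<U>" "U `` {x} \<subseteq> S" using induces_topologyD[OF ind] by blast
    then obtain R where R: "R \<in> I" "R `` {x} \<subseteq> S" using base I_def by blast
    have "R `` {x} = R `` {y}" using fun_cong[OF xy(3), of R] R by (simp add: f_def)
    then show False using R S xy eqv[OF R(1)] by (auto dest: equiv_class_self)
  qed
  \<comment> \<open>A continuous bijection from a compact space onto a Hausdorff space is a
    homeomorphism.\<close>
  have "Hausdorff_space ?LT"
    unfolding inverse_limit_topology_def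
    by (intro Hausdorff_space_subtopology) (simp add: Hausdorff_space_product_topology)
  moreover have "f ` topspace X = topspace ?LT" using fL surj tX tL by auto
  ultimately have "homeomorphic_map X ?LT f"
    using continuous_imp_homeomorphic_map[OF cf cX] inj tX by simp
  then have "is_limit_of G X I r F \<phi>"
    unfolding is_limit_of_def topological_digraph_iso_def using sys fm by blast
  \<comment> \<open>The quotients have carriers of type \<open>'a set\<close> set, whereas
    \<open>profinite_digraph\<close> asks for sets of natural numbers; the rule transfers the
    system.\<close>
  then show ?thesis by (rule profinite_digraphI[OF top])
qed

text \<open>Compactness forces \<U> to be \<open>diagonal_nhds X\<close>, the uniformity used in the
  forward direction; the converse is available for \<U> itself.\<close>

theorem theorem3p4:
  fixes G :: "'a digraph" and X :: "'a topology" and \<U> :: "('a \<times> 'a) set set"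
  assumes "is_digraph G" and "topspace X = arrows G"
    and "compact_space X" and "Hausdorff_space X"
    and "is_uniformity (topspace X) \<U>" and "induces_topology \<U> X"
  shows "profinite_digraph G X \<longleftrightarrow> is_uniformity_base {R. cofinite_entourage G \<U> R} \<U>"
  using profinite_imp_cofinite_base[OF assms(3)] cofinite_base_imp_profinite[OF assms]
    induced_uniformity_eq_diagonal_nhds[OF assms(3,5,6)]
  by metis

end
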